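(* For each pair of integers $n > m \geq 1$ there exist complex polynomials $p(z), q(z)$, with $p$ of degree $n$ and $q$ of degree $m$, such that the valence of the harmonic polynomial $h(z) = p(z) + \overline{q(z)}$ is at least $\lceil n\sqrt{m}\, \rceil$.
   Context: The valence of a function $h : \mathbb{C} \to \mathbb{C}$ is the maximum number of preimages of a given point, i.e. $\max_{w \in \mathbb{C}} |\{ z \in \mathbb{C} : h(z) = w\}|$, where preimages are counted as distinct points (without multiplicity). It is known that for $h = p + \overline{q}$ with $\deg p = n > m = \deg q$ the valence is finite and at most $n^2$. *)

theory Defs
  imports "HOL-Analysis.Analysis" "HOL-Computational_Algebra.Polynomial"
    "HOL-Library.Extended_Nat"
begin

text \<open>The maximal number of distinct preimages of a point. It takes values in the extended
  naturals, so that infinite or unbounded fibres give \<open>\<infinity>\<close> instead of the junk value of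
  \<^const>\<open>card\<close> or \<^const>\<open>Max\<close>. A finite supremum of extended naturals is attained, so the
  supremum is the maximum whenever it is finite.\<close>

definition valence :: "(complex \<Rightarrow> complex) \<Rightarrow> enat" where
  "valence h =
    (SUP w. if finite {z. h z = w} then enat (card {z. h z = w}) else \<infinity>)"

end

theory Submission
  imports Defs
begin

text \<open>
  The bound follows from a harmonic polynomial with at least \<open>n * m\<close> zeros, which suffices
  because \<open>sqrt m \<le> m\<close>. For \<open>p = q + 2 * e * z ^ n\<close> with a real number \<open>e\<close>,
  \<open>h z = p z + cnj (q z) = 2 * (Re (q z) + e * z ^ n)\<close>.
  On the \<open>n\<close> lines through the origin on which \<open>z ^ n\<close> is real, this is a real function:
  at \<open>z = r * cis (pi * j / n)\<close> with \<open>r\<close> real, the equation \<open>h z = 0\<close> becomes one real polynomial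
  equation in \<open>r\<close>. It remains to choose \<open>q\<close>, of degree \<open>m\<close>, and \<open>e\<close> so that on all \<open>n\<close> lines
  at once this real polynomial has \<open>m\<close> distinct nonzero real roots.

  Take \<open>q z = (\<Sum>k\<le>m. t k * c * z ^ k)\<close> with \<open>t k > 0\<close>. The restriction of \<open>Re q\<close> to a line has
  the coefficients \<open>t k * Re (c * cis (pi * j / n) ^ k)\<close>. The phase \<open>c = cis (pi / (4 * n))\<close>
  makes all of these nonzero (lemma \<open>phase_avoids_imaginary_axis\<close>). If \<open>t\<close> decreases fast enough,
  each new term \<open>k + 1\<close> preserves the existing sign changes and creates one more, far out on
  the positive or on the negative half line, whatever the signs of the coefficients are
  (lemmas \<open>common_perturbation\<close>, \<open>alternates_extend\<close> and \<open>common_scaling_alternates\<close>). The term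
  \<open>e * z ^ n\<close> with small \<open>e\<close> is one more harmless perturbation. Since \<open>Re c\<close> is nonzero, the
  origin, the only common point of the lines, is not a zero, so the \<open>n * m\<close> zeros are distinct.
\<close>

section \<open>Alternating real functions\<close>

text \<open>The factor \<open>s\<close> carries the sign of the first value, so that a point can be put in front
  of the sequence by replacing \<open>s\<close> by \<open>-s\<close>.\<close>

definition alternates :: "nat \<Rightarrow> (real \<Rightarrow> real) \<Rightarrow> bool" where
  "alternates m f \<longleftrightarrow>
    (\<exists>(x :: nat \<Rightarrow> real) s. strict_mono_on {..m} x \<and> (\<forall>i\<le>m. 0 < s * (-1) ^ i * f (x i)))"

lemma alternates_imp_roots:
  assumes alt: "alternates m f" and cont: "continuous_on UNIV f"
  shows "\<exists>Z. finite Z \<and> card Z = m \<and> (\<forall>r\<in>Z. f r = 0)"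
proof -
  obtain x s where mono: "strict_mono_on {..m} x"
    and sgn: "\<And>i. i \<le> m \<Longrightarrow> 0 < s * (-1) ^ i * f (x i)"
    using alt unfolding alternates_def by blast
  have "\<exists>y. x i < y \<and> y < x (Suc i) \<and> f y = 0" if i: "i < m" for i
  proof -
    let ?g = "\<lambda>y. s * (-1) ^ i * f y"
    have lt: "x i < x (Suc i)"
      using mono i by (auto simp: strict_mono_on_def)
    have pos: "0 < ?g (x i)" and neg: "?g (x (Suc i)) < 0"
      using sgn[of i] sgn[of "Suc i"] i by auto
    have "continuous_on {x i..x (Suc i)} ?g"
      by (intro continuous_intros continuous_on_subset[OF cont]) auto
    then obtain y where y: "x i \<le> y" "y \<le> x (Suc i)" "?g y = 0"
      using IVT2'[of ?g "x (Suc i)" 0 "x i"] lt pos neg by auto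
    have "s \<noteq> 0" using pos by auto
    then have "f y = 0" using y(3) by simp
    moreover have "y \<noteq> x i" "y \<noteq> x (Suc i)" using y(3) pos neg by auto
    ultimately show ?thesis using y by force
  qed
  then obtain y where y: "\<And>i. i < m \<Longrightarrow> x i < y i \<and> y i < x (Suc i) \<and> f (y i) = 0"
    by metis
  have "y i < y j" if "i < j" "j < m" for i j
  proof -
    have "x (Suc i) \<le> x j"
      using mono that by (cases "Suc i = j") (auto simp: strict_mono_on_def less_imp_le)
    then show ?thesis using y[of i] y[of j] that by auto
  qed
  then have "inj_on y {..<m}"
    by (intro linorder_inj_onI') (auto, fastforce)
  then have "card (y ` {..<m}) = m" by (simp add: card_image)
  then show ?thesis using y by (intro exI[of _ "y ` {..<m}"]) auto
qed

text \<open>Strict inequalities at finitely many points are an open condition.\<close>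

lemma alternates_perturb:
  assumes "alternates m f"
  shows "\<forall>\<^sub>F e in at_right 0. alternates m (\<lambda>x. f x + e * g x)"
proof -
  obtain x s where mono: "strict_mono_on {..m} x"
    and sgn: "\<And>i. i \<le> m \<Longrightarrow> 0 < s * (-1) ^ i * f (x i)"
    using assms unfolding alternates_def by blast
  have "\<forall>\<^sub>F e in at_right 0. 0 < s * (-1) ^ i * (f (x i) + e * g (x i))" if "i \<le> m" for i
  proof -
    have "((\<lambda>e. s * (-1) ^ i * (f (x i) + e * g (x i))) \<longlongrightarrow>
        s * (-1) ^ i * (f (x i) + 0 * g (x i))) (at_right 0)"
      by (intro tendsto_intros)
    then show ?thesis using order_tendstoD(1)[of _ _ _ 0] sgn[OF that] by simp
  qed
  then have "\<forall>\<^sub>F e in at_right 0. \<forall>i\<in>{..m}. 0 < s * (-1) ^ i * (f (x i) + e * g (x i))"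
    by (intro eventually_ball_finite) auto
  then show ?thesis
    by eventually_elim (use mono in \<open>auto simp: alternates_def\<close>)
qed

lemma common_perturbation:
  fixes f g :: "'a \<Rightarrow> real \<Rightarrow> real"
  assumes "finite J" and "\<And>j. j \<in> J \<Longrightarrow> alternates m (f j)"
  shows "\<exists>e>0. \<forall>j\<in>J. alternates m (\<lambda>x. f j x + e * g j x)"
proof -
  have "\<forall>\<^sub>F e in at_right 0. \<forall>j\<in>J. alternates m (\<lambda>x. f j x + e * g j x)"
    using assms by (intro eventually_ball_finite ballI alternates_perturb)
  moreover have "\<forall>\<^sub>F e in at_right 0. (0 :: real) < e"
    by (simp add: eventually_at_right_less)
  ultimately have "\<forall>\<^sub>F e in at_right 0.
      0 < e \<and> (\<forall>j\<in>J. alternates m (\<lambda>x. f j x + e * g j x))"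
    by eventually_elim blast
  from eventually_happens[OF this] show ?thesis
    by simp
qed

lemma poly_sign_right:
  fixes H :: "real poly"
  assumes "H \<noteq> 0"
  shows "\<exists>R>a. 0 < lead_coeff H * poly H R"
proof -
  define G where "G = smult (lead_coeff H) H"
  have "lead_coeff G = lead_coeff H * lead_coeff H" by (simp add: G_def)
  then have pos: "0 < lead_coeff G"
    using assms by (metis leading_coeff_0_iff not_real_square_gt_zero)
  then obtain b where "\<forall>x\<ge>b. lead_coeff G \<le> poly G x"
    using poly_pinfty_gt_lc by blast
  then have "0 < poly G (max b (a + 1))" using pos by (meson max.cobounded1 less_le_trans)
  then show ?thesis by (intro exI[of _ "max b (a + 1)"]) (auto simp: G_def)
qed

lemma poly_sign_left:
  fixes H :: "real poly"
  assumes "H \<noteq> 0"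
  shows "\<exists>R<a. 0 < lead_coeff H * (-1) ^ degree H * poly H R"
proof -
  define G where "G = pcompose H [:0, -1:]"
  have lc: "lead_coeff G = lead_coeff H * (-1) ^ degree H"
    unfolding G_def by (subst lead_coeff_comp) auto
  then have "G \<noteq> 0" using assms by auto
  then obtain R where "R > -a" "0 < lead_coeff G * poly G R"
    using poly_sign_right by blast
  then show ?thesis
    using lc by (intro exI[of _ "-R"]) (auto simp: G_def poly_pcompose)
qed

text \<open>Along the alternating points the sign changes \<open>m\<close> times, while between the two ends of the
  real line a polynomial of degree \<open>m + 1\<close> changes sign with the parity of \<open>m + 1\<close>. Hence, at
  exactly one of the two ends, the sign near infinity differs from that at the extreme
  alternating point, and there a further alternating point is found.\<close>

lemma alternates_extend:
  assumes alt: "alternates m (poly H)" and deg: "degree H = Suc m"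
  shows "alternates (Suc m) (poly H)"
proof -
  obtain x s where mono: "strict_mono_on {..m} x"
    and sgn: "\<And>i. i \<le> m \<Longrightarrow> 0 < s * (-1) ^ i * poly H (x i)"
    using alt unfolding alternates_def by blast
  define L where "L = lead_coeff H"
  have H0: "H \<noteq> 0" using deg by auto
  have "s \<noteq> 0" using sgn[of 0] by auto
  then have "s * (-1) ^ m * L \<noteq> 0" using H0 by (simp add: L_def)
  then consider "s * (-1) ^ m * L < 0" | "0 < s * (-1) ^ m * L" by linarith
  then show ?thesis
  proof cases
    case 1
    obtain R where R: "R > x m" "0 < L * poly H R"
      using poly_sign_right[OF H0] L_def by blast
    have "(s * (-1) ^ m * L) * (L * poly H R) < 0"
      using 1 R(2) by (rule mult_neg_pos)
    then have "(L * L) * (s * (-1) ^ m * poly H R) < 0" by (simp add: mult_ac)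
    then have new: "s * (-1) ^ m * poly H R < 0"
      by (metis mult_less_0_iff not_square_less_zero)
    have "x i < R" if "i \<le> m" for i
      using strict_mono_on_leD[OF mono, of i m] R(1) that by simp
    then have "strict_mono_on {..Suc m} (x(Suc m := R))"
      using mono by (auto simp: strict_mono_on_def)
    moreover have "0 < s * (-1) ^ i * poly H ((x(Suc m := R)) i)" if "i \<le> Suc m" for i
      using that sgn[of i] new by (cases "i = Suc m") auto
    ultimately show ?thesis unfolding alternates_def by blast
  next
    case 2
    obtain R where R: "R < x 0" "0 < L * (-1) ^ Suc m * poly H R"
      using poly_sign_left[OF H0] L_def deg by metis
    have "0 < (s * (-1) ^ m * L) * (L * (-1) ^ Suc m * poly H R)"
      using 2 R(2) by (rule mult_pos_pos)
    also have "\<dots> = (L * L) * (- s * poly H R) * ((-1) ^ m * (-1) ^ m)"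
      by (simp add: mult_ac)
    also have "(-1) ^ m * (-1) ^ m = (1 :: real)"
      by (simp flip: power_mult_distrib)
    finally have new: "0 < - s * poly H R"
      by (metis mult.right_neutral not_square_less_zero zero_less_mult_iff)
    have "R < x i" if "i \<le> m" for i
      using strict_mono_on_leD[OF mono, of 0 i] R(1) that by simp
    then have "strict_mono_on {..Suc m} (case_nat R x)"
      using mono by (auto simp: strict_mono_on_def split: nat.split)
    moreover have "0 < (- s) * (-1) ^ i * poly H (case_nat R x i)" if "i \<le> Suc m" for i
      using that sgn[of "i - 1"] new by (cases i) auto
    ultimately show ?thesis unfolding alternates_def by blast
  qed
qed

section \<open>One scaling for finitely many coefficient sequences\<close>

text \<open>The index set \<open>J\<close> will stand for the lines. The scaling \<open>t\<close> may not depend on the line,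
  because it belongs to the coefficients of \<open>q\<close>; this is why each new factor has to be small
  enough for all lines simultaneously.\<close>

lemma common_scaling_alternates:
  fixes A :: "'a \<Rightarrow> nat \<Rightarrow> real"
  assumes fin: "finite J" and nz: "\<And>j k. j \<in> J \<Longrightarrow> A j k \<noteq> 0"
  shows "\<exists>t. (\<forall>k. 0 < t k) \<and> (\<forall>j\<in>J. alternates m (\<lambda>x. \<Sum>k\<le>m. t k * A j k * x ^ k))"
proof (induction m)
  case 0
  have "alternates 0 (\<lambda>x. \<Sum>k\<le>0. 1 * A j k * x ^ k)" if "j \<in> J" for j
  proof -
    have "0 < A j 0 * A j 0" using nz[OF that] by (metis not_real_square_gt_zero)
    then show ?thesis
      unfolding alternates_def
      by (intro exI[of _ "\<lambda>i. 0"] exI[of _ "A j 0"]) (auto simp: strict_mono_on_def)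
  qed
  then show ?case by (intro exI[of _ "\<lambda>k. 1"]) auto
next
  case (Suc m)
  then obtain t where t: "\<And>k. 0 < t k"
    and alt: "\<And>j. j \<in> J \<Longrightarrow> alternates m (\<lambda>x. \<Sum>k\<le>m. t k * A j k * x ^ k)"
    by blast
  from common_perturbation[of J m "\<lambda>j x. \<Sum>k\<le>m. t k * A j k * x ^ k"
      "\<lambda>j x. A j (Suc m) * x ^ Suc m", OF fin alt]
  obtain e :: real where e: "0 < e" and alt_e: "\<And>j. j \<in> J \<Longrightarrow>
      alternates m (\<lambda>x. (\<Sum>k\<le>m. t k * A j k * x ^ k) + e * (A j (Suc m) * x ^ Suc m))"
    by blast
  define t' where "t' = t(Suc m := e)"
  have "alternates (Suc m) (\<lambda>x. \<Sum>k\<le>Suc m. t' k * A j k * x ^ k)" if j: "j \<in> J" for j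
  proof -
    define H where "H = (\<Sum>k\<le>Suc m. monom (t' k * A j k) k)"
    have poly_H: "poly H = (\<lambda>x. \<Sum>k\<le>Suc m. t' k * A j k * x ^ k)"
      by (simp add: H_def poly_sum poly_monom fun_eq_iff)
    have coeff_H: "coeff H i = (if i \<le> Suc m then t' i * A j i else 0)" for i
      by (simp add: H_def coeff_sum sum.delta' del: sum.atMost_Suc)
    have "coeff H (Suc m) \<noteq> 0"
      using e nz[OF j] by (simp add: coeff_H t'_def)
    then have "degree H = Suc m"
      by (intro antisym degree_le le_degree) (auto simp: coeff_H)
    moreover have "(\<lambda>x. (\<Sum>k\<le>m. t k * A j k * x ^ k) + e * (A j (Suc m) * x ^ Suc m)) = poly H"
      by (auto simp: poly_H t'_def fun_eq_iff mult.assoc intro!: sum.cong)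
    ultimately show ?thesis
      using alternates_extend alt_e[OF j] poly_H by metis
  qed
  moreover have "0 < t' k" for k using t e by (simp add: t'_def)
  ultimately show ?case by blast
qed

section \<open>Lines through the origin\<close>

text \<open>The argument of the product is \<open>(4 * j * k + 1) * pi / (4 * n)\<close>. It is an odd multiple of
  \<open>pi / 2\<close> only if the odd number \<open>4 * j * k + 1\<close> is a multiple of \<open>2 * n\<close>.\<close>

lemma phase_avoids_imaginary_axis:
  fixes n j k :: nat
  assumes "n > 0"
  shows "Re (cis (pi / (4 * real n)) * cis (pi * real j / real n) ^ k) \<noteq> 0"
proof
  assume "Re (cis (pi / (4 * real n)) * cis (pi * real j / real n) ^ k) = 0"
  then have "cos (pi / (4 * real n) + real k * (pi * real j / real n)) = 0"
    by (simp add: Complex.DeMoivre cis_mult)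
  then obtain i :: int
    where "pi / (4 * real n) + real k * (pi * real j / real n) = of_int i * (pi / 2)"
    using cos_zero_iff_int by blast
  then have "pi * (1 + 4 * real k * real j) = pi * (2 * of_int i * real n)"
    using assms by (simp add: field_simps)
  then have "1 + 4 * real k * real j = 2 * of_int i * real n" by simp
  then have "real_of_int (1 + 4 * int k * int j) = real_of_int (2 * i * int n)" by simp
  then have "1 + 4 * int k * int j = 2 * i * int n" using of_int_eq_iff by blast
  moreover have "odd (1 + 4 * int k * int j)" by simp
  ultimately show False by simp
qed

lemma lines_meet_only_at_origin:
  fixes n i j :: nat and r s :: real
  assumes "i < n" "j < n" "r \<noteq> 0"
    and eq: "of_real r * cis (pi * real i / real n) = of_real s * cis (pi * real j / real n)"
  shows "i = j \<and> r = s"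
proof -
  define d where "d = pi * real i / real n - pi * real j / real n"
  have "of_real r * cis d = of_real r * cis (pi * real i / real n) / cis (pi * real j / real n)"
    by (simp add: d_def flip: cis_divide)
  also have "\<dots> = of_real s" by (simp add: eq)
  finally have rot: "of_real r * cis d = complex_of_real s" .
  have "r * sin d = 0" using arg_cong[OF rot, of Im] by simp
  then have "sin d = 0" using assms(3) by simp
  then obtain l :: int where "d = of_int l * pi" using sin_zero_iff_int2 by blast
  then have "pi * (real i - real j) = pi * (of_int l * real n)"
    using assms(1) by (simp add: d_def field_simps)
  then have "real_of_int (int i - int j) = real_of_int (l * int n)" by simp
  then have l: "int i - int j = l * int n" using of_int_eq_iff by blast
  have "int n dvd int i - int j" by (simp add: l)
  then have "i = j" using assms(1,2) zdvd_imp_le[of "int n" "int i - int j"]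
      zdvd_imp_le[of "int n" "int j - int i"] by (force simp: dvd_diff_commute)
  then show ?thesis using rot by (simp add: d_def)
qed

section \<open>The harmonic polynomial\<close>

lemma card_le_valence:
  assumes "finite S" and "\<And>z. z \<in> S \<Longrightarrow> h z = w"
  shows "enat (card S) \<le> valence h"
proof -
  have "enat (card S) \<le> (if finite {z. h z = w} then enat (card {z. h z = w}) else \<infinity>)"
    using assms by (auto intro!: card_mono)
  also have "\<dots> \<le> valence h"
    unfolding valence_def by (rule SUP_upper) simp
  finally show ?thesis .
qed

theorem theorem1p1:
  fixes n m :: nat
  assumes "m \<ge> 1" and "n > m"
  shows "\<exists>p q :: complex poly. degree p = n \<and> degree q = m \<and>
    valence (\<lambda>z. poly p z + cnj (poly q z)) \<ge> enat (nat \<lceil>real n * sqrt (real m)\<rceil>)"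
proof -
  have n: "n > 0" using assms by simp
  define c where "c = cis (pi / (4 * real n))"
  define w where "w = (\<lambda>j::nat. cis (pi * real j / real n))"
  define A where "A = (\<lambda>j k. Re (c * w j ^ k))"
  have A_nz: "A j k \<noteq> 0" for j k
    unfolding A_def c_def w_def by (rule phase_avoids_imaginary_axis[OF n])
  obtain t where t: "\<And>k. 0 < t k"
    and alt: "\<And>j. j < n \<Longrightarrow> alternates m (\<lambda>x. \<Sum>k\<le>m. t k * A j k * x ^ k)"
    using common_scaling_alternates[of "{..<n}" A m] A_nz by blast
  from common_perturbation[of "{..<n}" m "\<lambda>j x. \<Sum>k\<le>m. t k * A j k * x ^ k"
      "\<lambda>j x. (-1) ^ j * x ^ n"]
  obtain e :: real where e: "0 < e" and alt_e: "\<And>j. j < n \<Longrightarrow>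
      alternates m (\<lambda>x. (\<Sum>k\<le>m. t k * A j k * x ^ k) + e * ((-1) ^ j * x ^ n))"
    using alt by blast
  define F where "F = (\<lambda>j x. (\<Sum>k\<le>m. t k * A j k * x ^ k) + e * ((-1) ^ j * x ^ n))"
  have "\<exists>Z. finite Z \<and> card Z = m \<and> (\<forall>r\<in>Z. F j r = 0)" if "j < n" for j
    unfolding F_def by (intro alternates_imp_roots alt_e that continuous_intros)
  then obtain Z where Z: "\<And>j. j < n \<Longrightarrow> finite (Z j) \<and> card (Z j) = m \<and> (\<forall>r\<in>Z j. F j r = 0)"
    by metis
  \<comment> \<open>The constant terms do not vanish, so the roots found on different lines avoid the origin.\<close>
  have F0: "F j 0 \<noteq> 0" for j
    using t[of 0] A_nz[of j 0] n by (simp add: F_def power_0_left sum.atMost_shift)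

  define q where "q = (\<Sum>k\<le>m. monom (of_real (t k) * c) k)"
  define p where "p = q + monom (of_real (2 * e)) n"
  define h where "h = (\<lambda>z. poly p z + cnj (poly q z))"
  have coeff_q: "coeff q i = (if i \<le> m then of_real (t i) * c else 0)" for i
    by (simp add: q_def coeff_sum sum.delta')
  have "coeff q m \<noteq> 0" using t[of m] by (simp add: coeff_q c_def)
  then have deg_q: "degree q = m"
    by (intro antisym degree_le le_degree) (auto simp: coeff_q)
  have deg_p: "degree p = n"
    unfolding p_def using e assms(2) deg_q
    by (subst degree_add_eq_right) (auto simp: degree_monom_eq)

  have h_line: "h (of_real r * w j) = of_real (2 * F j r)" for j r
  proof -
    have "poly q (of_real r * w j) = (\<Sum>k\<le>m. of_real (t k * r ^ k) * (c * w j ^ k))"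
      by (simp add: q_def poly_sum poly_monom power_mult_distrib mult_ac)
    then have Re_q: "Re (poly q (of_real r * w j)) = (\<Sum>k\<le>m. t k * A j k * r ^ k)"
      by (simp add: A_def algebra_simps del: of_real_mult of_real_power)
    have "w j ^ n = (-1) ^ j"
    proof -
      have "w j ^ n = cis (real j * pi)"
        using n by (simp add: w_def Complex.DeMoivre mult.commute)
      also have "\<dots> = cis pi ^ j" by (simp only: Complex.DeMoivre)
      finally show ?thesis by simp
    qed
    then have "h (of_real r * w j) = (poly q (of_real r * w j) + cnj (poly q (of_real r * w j)))
        + of_real (2 * e * ((-1) ^ j * r ^ n))"
      by (simp add: h_def p_def poly_monom power_mult_distrib mult_ac)
    also have "\<dots> = of_real (2 * F j r)"
      unfolding complex_add_cnj Re_q F_def by (simp add: algebra_simps)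
    finally show ?thesis .
  qed

  define S where "S = (\<lambda>(j, r). of_real r * w j) ` (SIGMA j:{..<n}. Z j)"
  have "inj_on (\<lambda>(j, r). of_real r * w j) (SIGMA j:{..<n}. Z j)"
  proof (rule inj_onI, clarify)
    fix i r j s
    assume *: "i < n" "j < n" "r \<in> Z i" "s \<in> Z j" "of_real r * w i = of_real s * w j"
    have "r \<noteq> 0" using Z[of i] F0[of i] * by auto
    then show "i = j \<and> r = s"
      using lines_meet_only_at_origin[of i n j r s] * by (simp add: w_def)
  qed
  then have "card S = n * m"
    using Z by (simp add: S_def card_image)
  moreover have "finite S" unfolding S_def using Z by (intro finite_imageI finite_SigmaI) auto
  moreover have "h z = 0" if "z \<in> S" for z
    using that Z by (auto simp: S_def h_line)
  ultimately have val: "enat (n * m) \<le> valence h"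
    using card_le_valence[of S h 0] by simp

  have "sqrt (real m) \<le> real m"
    using assms(1) by (intro real_le_lsqrt) (auto simp: power2_eq_square)
  then have "real n * sqrt (real m) \<le> real (n * m)"
    by (simp add: mult_left_mono)
  then have "nat \<lceil>real n * sqrt (real m)\<rceil> \<le> n * m"
    by (simp add: ceiling_le_iff nat_le_iff)
  then have "enat (nat \<lceil>real n * sqrt (real m)\<rceil>) \<le> valence h"
    using val by (meson enat_ord_simps(1) order_trans)
  then show ?thesis
    using deg_p deg_q unfolding h_def by blast
qed

end
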